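(* Let $\alpha\in(0,1)$, and let $R=R(Z)$ be the output of the conformal link prediction procedure at level $\alpha$ described in the context, run with a scoring function $g$ of the following form: for some $K\in\{1,\dots,n\}$ and some real-valued measurable function $h(\cdot\,;\cdot)$, for every $z=(a,x,\omega)\in\mathcal Z$ and all $1\le i,j\le n$, $$g(z)_{i,j}=h\Big(\big(w(a)_{i,j},x_{N(i,K),\bullet},x_{N(j,K),\bullet}\big)\,;\,\big\{\big(w(a)_{u,v},x_{N(u,K),\bullet},x_{N(v,K),\bullet},a_{u,v}\big)\,:\,\omega_{u,v}=1\big\}\Big).$$ Assume that (a) the score matrix $g(Z_{\mathrm{train}})=(S_{i,j})_{1\le i,j\le n}$ has no ties almost surely; (b) the calibration set size $\ell$ is a function of $k_0=|\mathcal D^0|$ and $\mathcal D^1$ only. Then $\mathrm{FDR}(R)\le\alpha$.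
   Context: **Model.** $n,d\ge1$ are integers. $A^*=(A^*_{i,j})_{1\le i,j\le n}\in\{0,1\}^{n\times n}$ is a random matrix (adjacency matrix of the true complete graph), $X\in\mathbb R^{n\times d}$ is a random matrix of node covariates, and $\Omega=(\Omega_{i,j})_{1\le i,j\le n}\in\{0,1\}^{n\times n}$ is the sampling matrix ($\Omega_{i,j}=1$ iff the status of $(i,j)$ is observed). The joint law of $(A^*,X)$ is arbitrary; conditionally on $(A^*,X)$, the entries of $\Omega$ are independent with $\Omega_{i,j}\sim\mathrm{Bernoulli}\big(w_0\mathbf 1_{A^*_{i,j}=0}+w_1\mathbf 1_{A^*_{i,j}=1}\big)$ for some unknown $w_0,w_1\in[0,1]$. $P$ denotes the law of $Z^*=(A^*,X,\Omega)$. The observed adjacency matrix is $A_{i,j}=\Omega_{i,j}A^*_{i,j}$, the observation is $Z=(A,X,\Omega)$, and $\mathcal Z$ is the observation space. **Sets of pairs.** All are subsets of $\{1,\dots,n\}^2$: $\mathcal D_{\mathrm{test}}=\{(i,j):\Omega_{i,j}=0\}$, $\mathcal D=\{(i,j):\Omega_{i,j}=1\}$, $\mathcal D^0=\{(i,j)\in\mathcal D:A^*_{i,j}=0\}$, $\mathcal D^1=\{(i,j)\in\mathcal D:A^*_{i,j}=1\}$, $\mathcal H_0=\{(i,j):\Omega_{i,j}=0,A^*_{i,j}=0\}$, $\mathcal H_1=\{(i,j):\Omega_{i,j}=0,A^*_{i,j}=1\}$. Set $m=|\mathcal D_{\mathrm{test}}|$. **Scoring function notation.** A scoring function is a measurable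 $g:\mathcal Z\to\mathbb R^{n\times n}$. For an adjacency matrix $a$, $w(a)_{i,j}=(a_{i,\bullet},a_{j,\bullet},a^2_{i,\bullet},a^2_{j,\bullet},\dots,a^K_{i,\bullet},a^K_{j,\bullet})$, where $a^k_{i,\bullet}$ is the $i$-th row of the $k$-th matrix power of $a$; $N(i,K)$ is the $K$-hop neighborhood of node $i$ (in the graph with adjacency matrix $a$); for $S\subset\{1,\dots,n\}$, $x_{S,\bullet}=(x_{u,l})_{u\in S,1\le l\le d}$. **Procedure (level $\alpha$).** 1. Given $Z$, draw $\mathcal D_{\mathrm{cal}}$ of size $\ell\le k_0$ uniformly without replacement from $\mathcal D^0$ (conditionally on $Z^*$). 2. Set $Z_{\mathrm{train}}=(A,X,\Omega_{\mathrm{train}})$, with $(\Omega_{\mathrm{train}})_{i,j}=0$ if $(i,j)\in\mathcal D_{\mathrm{cal}}$ and $(\Omega_{\mathrm{train}})_{i,j}=\Omega_{i,j}$ otherwise. 3. Compute the scores $S_{i,j}=g(Z_{\mathrm{train}})_{i,j}$. 4. For $(i,j)\in\mathcal D_{\mathrm{test}}$ compute the conformal $p$-value $$p_{i,j}=\frac1{\ell+1}\Big(1+\sum_{(u,v)\in\mathcal D_{\mathrm{cal}}}\mathbf 1\{S_{i,j}\le S_{u,v}\}\Big).$$ 5. Apply the Benjamini–Hochberg procedure to $(p_{i,j})_{(i,j)\in\mathcal D_{\mathrm{test}}}$: with $0=p_{(0)}\le p_{(1)}\le\dots\le p_{(m)}$ the sorted $p$-values and $\hat k=\max\{k\in\{0,\dots,m\}:p_{(k)}\le\alpha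 k/m\}$, output $R=\{(i,j)\in\mathcal D_{\mathrm{test}}:p_{i,j}\le\alpha\hat k/m\}$ (with $R=\emptyset$ if $m=0$). "No ties" means that the entries $S_{i,j}$, $1\le i,j\le n$, are pairwise distinct. **Error rate.** $\mathrm{FDP}(R)=\dfrac{|R\cap\mathcal H_0|}{1\vee|R|}$ and $\mathrm{FDR}(R)=\mathbb E[\mathrm{FDP}(R)]$, the expectation being over $Z^*\sim P$ and the draw of $\mathcal D_{\mathrm{cal}}$. *)

theory Defs
  imports "HOL-Probability.Probability"
begin

definition entry :: "'b ^ 'm ^ 'n \<Rightarrow> 'n \<times> 'm \<Rightarrow> 'b" where
  "entry a e = a $ fst e $ snd e"

definition binary_matrices :: "(nat ^ 'm ^ 'n) set" where
  "binary_matrices = {a. \<forall>i j. a $ i $ j \<in> {0, 1}}"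

type_synonym ('n, 'd) obs = "(nat ^ 'n ^ 'n) \<times> (real ^ 'd ^ 'n) \<times> (nat ^ 'n ^ 'n)"

definition obs_space :: "('n::finite, 'd::finite) obs measure" where
  "obs_space =
     count_space binary_matrices \<Otimes>\<^sub>M (borel \<Otimes>\<^sub>M count_space binary_matrices)"

definition observed_adjacency :: "nat ^ 'n ^ 'n \<Rightarrow> nat ^ 'n ^ 'n \<Rightarrow> nat ^ 'n ^ 'n" where
  "observed_adjacency om astar = (\<chi> i j. om $ i $ j * astar $ i $ j)"

definition test_pairs :: "nat ^ 'n ^ 'n \<Rightarrow> ('n \<times> 'n) set" where
  "test_pairs om = {e. entry om e = 0}"

definition sampled_pairs :: "nat ^ 'n ^ 'n \<Rightarrow> ('n \<times> 'n) set" where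
  "sampled_pairs om = {e. entry om e = 1}"

definition sampled_nonedges :: "nat ^ 'n ^ 'n \<Rightarrow> nat ^ 'n ^ 'n \<Rightarrow> ('n \<times> 'n) set" where
  "sampled_nonedges astar om = {e \<in> sampled_pairs om. entry astar e = 0}"

definition sampled_edges :: "nat ^ 'n ^ 'n \<Rightarrow> nat ^ 'n ^ 'n \<Rightarrow> ('n \<times> 'n) set" where
  "sampled_edges astar om = {e \<in> sampled_pairs om. entry astar e = 1}"

definition test_nulls :: "nat ^ 'n ^ 'n \<Rightarrow> nat ^ 'n ^ 'n \<Rightarrow> ('n \<times> 'n) set" where
  "test_nulls astar om = {e. entry om e = 0 \<and> entry astar e = 0}"

text \<open>The matrix power is taken with respect to the matrix product; the \<open>power\<close> class operation
  on vectors would be the entrywise one.\<close>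

definition matrix_power :: "nat ^ 'n ^ 'n \<Rightarrow> nat \<Rightarrow> nat ^ 'n ^ 'n" where
  "matrix_power a k = (((**) a) ^^ k) (mat 1)"

definition walk_features :: "nat \<Rightarrow> nat ^ 'n ^ 'n \<Rightarrow> 'n \<Rightarrow> 'n \<Rightarrow> (nat ^ 'n) list" where
  "walk_features K a i j =
     concat (map (\<lambda>k. [row i (matrix_power a k), row j (matrix_power a k)]) [1..<Suc K])"

text \<open>Nodes at graph distance at most \<open>K\<close> from \<open>i\<close>, including \<open>i\<close> itself. The adjacency matrix need
  not be symmetric; edges are followed in their direction.\<close>

definition hop_neighborhood :: "nat ^ 'n ^ 'n \<Rightarrow> 'n \<Rightarrow> nat \<Rightarrow> 'n set" where
  "hop_neighborhood a i K = {j. \<exists>k\<le>K. (i, j) \<in> {(u, v). a $ u $ v = 1} ^^ k}"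

text \<open>The family of covariates indexed by a set of nodes \<open>S\<close> is a partial map with domain \<open>S\<close>.\<close>

definition covariates_on :: "real ^ 'd ^ 'n \<Rightarrow> 'n set \<Rightarrow> ('n \<rightharpoonup> real ^ 'd)" where
  "covariates_on x S = (\<lambda>u. Some (x $ u)) |` S"

text \<open>The disjoint union over all \<open>S\<close> of the Borel spaces of families indexed by \<open>S\<close>. It is
  presented through the injection sending a family to its domain and its extension by zero.\<close>

definition covariate_family_space :: "('n::finite \<rightharpoonup> real ^ 'd::finite) measure" where
  "covariate_family_space =
     vimage_algebra UNIV
       (\<lambda>f. (dom f, \<chi> u. case f u of None \<Rightarrow> 0 | Some y \<Rightarrow> y))
       (count_space UNIV \<Otimes>\<^sub>M (borel :: (real ^ 'd ^ 'n) measure))"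

type_synonym ('n, 'd) feature =
  "(nat ^ 'n) list \<times> ('n \<rightharpoonup> real ^ 'd) \<times> ('n \<rightharpoonup> real ^ 'd)"

type_synonym ('n, 'd) labelled_feature =
  "(nat ^ 'n) list \<times> ('n \<rightharpoonup> real ^ 'd) \<times> ('n \<rightharpoonup> real ^ 'd) \<times> nat"

definition feature_space :: "('n::finite, 'd::finite) feature measure" where
  "feature_space =
     count_space UNIV \<Otimes>\<^sub>M (covariate_family_space \<Otimes>\<^sub>M covariate_family_space)"

definition labelled_feature_space :: "('n::finite, 'd::finite) labelled_feature measure" where
  "labelled_feature_space =
     count_space UNIV \<Otimes>\<^sub>M
       (covariate_family_space \<Otimes>\<^sub>M (covariate_family_space \<Otimes>\<^sub>M count_space UNIV))"

text \<open>As for simple point processes, the sigma-algebra on finite subsets is the one generated by the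
  hitting events of measurable sets.\<close>

definition finite_subset_space :: "'b measure \<Rightarrow> 'b set measure" where
  "finite_subset_space N =
     sigma {F. finite F \<and> F \<subseteq> space N}
       ((\<lambda>C. {F. finite F \<and> F \<subseteq> space N \<and> F \<inter> C \<noteq> {}}) ` sets N)"

definition feature ::
  "nat \<Rightarrow> nat ^ 'n ^ 'n \<Rightarrow> real ^ 'd ^ 'n \<Rightarrow> 'n \<Rightarrow> 'n \<Rightarrow> ('n, 'd) feature" where
  "feature K a x i j =
     (walk_features K a i j,
      covariates_on x (hop_neighborhood a i K),
      covariates_on x (hop_neighborhood a j K))"

definition labelled_feature ::
  "nat \<Rightarrow> nat ^ 'n ^ 'n \<Rightarrow> real ^ 'd ^ 'n \<Rightarrow> 'n \<Rightarrow> 'n \<Rightarrow> ('n, 'd) labelled_feature" where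
  "labelled_feature K a x u v =
     (walk_features K a u v,
      covariates_on x (hop_neighborhood a u K),
      covariates_on x (hop_neighborhood a v K),
      a $ u $ v)"

definition train_sampling :: "nat ^ 'n ^ 'n \<Rightarrow> ('n \<times> 'n) set \<Rightarrow> nat ^ 'n ^ 'n" where
  "train_sampling om Dcal = (\<chi> i j. if (i, j) \<in> Dcal then 0 else om $ i $ j)"

definition train_scores ::
  "(('n, 'd) obs \<Rightarrow> real ^ 'n ^ 'n) \<Rightarrow> ('n, 'd) obs \<Rightarrow> ('n \<times> 'n) set \<Rightarrow> real ^ 'n ^ 'n" where
  "train_scores g z Dcal = (case z of (a, x, om) \<Rightarrow> g (a, x, train_sampling om Dcal))"

definition no_ties :: "real ^ 'n ^ 'n \<Rightarrow> bool" where
  "no_ties S \<longleftrightarrow> inj (entry S)"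

definition conformal_pvalue ::
  "real ^ 'n ^ 'n \<Rightarrow> nat \<Rightarrow> ('n \<times> 'n) set \<Rightarrow> 'n \<times> 'n \<Rightarrow> real" where
  "conformal_pvalue S l Dcal e =
     (1 + (\<Sum>c\<in>Dcal. of_bool (entry S e \<le> entry S c))) / (real l + 1)"

text \<open>The \<open>k\<close>-th smallest value of \<open>p\<close> over \<open>T\<close>, counted with multiplicity, and \<open>0\<close> for \<open>k = 0\<close>.\<close>

definition order_statistic :: "('e \<Rightarrow> real) \<Rightarrow> 'e set \<Rightarrow> nat \<Rightarrow> real" where
  "order_statistic p T k = (0 # sorted_list_of_multiset (image_mset p (mset_set T))) ! k"

definition bh_count :: "real \<Rightarrow> ('e \<Rightarrow> real) \<Rightarrow> 'e set \<Rightarrow> nat" where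
  "bh_count \<alpha> p T =
     Max {k. k \<le> card T \<and> order_statistic p T k \<le> \<alpha> * real k / real (card T)}"

definition benjamini_hochberg :: "real \<Rightarrow> ('e \<Rightarrow> real) \<Rightarrow> 'e set \<Rightarrow> 'e set" where
  "benjamini_hochberg \<alpha> p T = {e \<in> T. p e \<le> \<alpha> * real (bh_count \<alpha> p T) / real (card T)}"

definition conformal_link_prediction ::
  "real \<Rightarrow> (('n, 'd) obs \<Rightarrow> real ^ 'n ^ 'n) \<Rightarrow> nat \<Rightarrow> ('n, 'd) obs \<Rightarrow> ('n \<times> 'n) set
     \<Rightarrow> ('n \<times> 'n) set" where
  "conformal_link_prediction \<alpha> g l z Dcal =
     (case z of (a, x, om) \<Rightarrow>
        benjamini_hochberg \<alpha> (conformal_pvalue (train_scores g z Dcal) l Dcal) (test_pairs om))"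

definition FDP :: "'e set \<Rightarrow> 'e set \<Rightarrow> real" where
  "FDP H0 R = real (card (R \<inter> H0)) / real (max 1 (card R))"

definition generated_algebra :: "'w measure \<Rightarrow> 'b measure \<Rightarrow> ('w \<Rightarrow> 'b) \<Rightarrow> 'w measure" where
  "generated_algebra M N Y = vimage_algebra (space M) Y N"

definition cond_prob_given :: "'w measure \<Rightarrow> 'w measure \<Rightarrow> 'w set \<Rightarrow> 'w \<Rightarrow> real" where
  "cond_prob_given M F E = real_cond_exp M F (indicator E)"

definition cond_indep_vars ::
  "'w measure \<Rightarrow> 'w measure \<Rightarrow> ('i \<Rightarrow> 'b measure) \<Rightarrow> ('i \<Rightarrow> 'w \<Rightarrow> 'b) \<Rightarrow> 'i set \<Rightarrow> bool" where
  "cond_indep_vars M F N Y I \<longleftrightarrow>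
     (\<forall>i\<in>I. Y i \<in> measurable M (N i)) \<and>
     (\<forall>J B. J \<subseteq> I \<longrightarrow> finite J \<longrightarrow> J \<noteq> {} \<longrightarrow> (\<forall>j\<in>J. B j \<in> sets (N j)) \<longrightarrow>
        (AE w in M.
           cond_prob_given M F (\<Inter>j\<in>J. Y j -` B j \<inter> space M) w =
           (\<Prod>j\<in>J. cond_prob_given M F (Y j -` B j \<inter> space M) w)))"

end

theory Submission
  imports Defs
begin

text \<open>Condition on the true graph \<open>a\<close> and the covariates \<open>x\<close>. The null pairs, where \<open>a\<close> vanishes,
  are then sampled independently with the common probability \<open>w0\<close>. Since the calibration size depends
  only on the number of sampled nulls and on the sampled edges, the joint law of the sampling matrix
  \<open>om\<close> and the calibration set \<open>C\<close> gives equal weight to all \<open>(om, C)\<close> that agree in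
  \<open>train_sampling om C\<close> and in \<open>card C\<close>. In such a class, \<open>C\<close> ranges over all subsets of a given
  size of the set \<open>N\<close> of nulls not sampled for training, and the tested nulls are \<open>N - C\<close>. The
  observed adjacency matrix is constant on the class, because removing or adding sampled nulls does not
  change it; hence so is the whole score matrix.

  The claim therefore reduces to fixed scores and a calibration set drawn uniformly from \<open>N\<close>
  (\<open>sum_FDP_calibration_le\<close>). The false discovery proportion is at most the sum over the tested nulls
  \<open>e\<close> of the indicator of rejection of \<open>e\<close> divided by the number \<open>k\<close> of rejections. Given
  \<open>B = insert e C\<close>, the element \<open>e\<close> is uniform on \<open>B\<close>, and \<open>k\<close> is nondecreasing in the score
  of \<open>e\<close> (\<open>bh_count_leave_one_out_mono\<close>). Let \<open>e\<close> be the rejected choice of least score, \<open>k\<close> its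
  number of rejections and \<open>r\<close> the number of elements of \<open>B\<close> with at least its score. At most
  \<open>r\<close> choices are rejected, each with at least \<open>k\<close> rejections, and \<open>r / card B \<le> \<alpha> * k / m\<close> where \<open>m\<close> is the number of tests; so each
  tested null contributes at most \<open>\<alpha> / m\<close> on average (\<open>sum_leave_one_out_le\<close>).

  It remains to pass from the conditional laws to these finite sums. The true graph, the sampling
  matrix and the calibration set take finitely many values, so the expectation is a finite sum of
  integrals from which the conditional probabilities of the calibration set and of the sampling matrix
  are pulled out in turn (\<open>integral_fixed_sampling\<close>).\<close>

section \<open>The Benjamini--Hochberg procedure in counting form\<close>

lemma sorted_nth_le_iff:
  fixes xs :: "'a::linorder list"
  assumes "sorted xs" "k < length xs"
  shows "xs ! k \<le> t \<longleftrightarrow> k < length (filter (\<lambda>x. x \<le> t) xs)"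
  using assms
proof (induction xs arbitrary: k)
  case (Cons x xs)
  show ?case
  proof (cases "x \<le> t")
    case True
    with Cons show ?thesis by (cases k) auto
  next
    case False
    with Cons.prems have "\<forall>y\<in>set xs. \<not> y \<le> t" by auto
    moreover have "\<not> (x # xs) ! k \<le> t"
      using False Cons.prems calculation by (cases k) auto
    ultimately show ?thesis using False by simp
  qed
qed simp

lemma order_statistic_le_iff:
  assumes "finite T" "k \<le> card T" "0 \<le> t"
  shows "order_statistic p T k \<le> t \<longleftrightarrow> k \<le> card {e \<in> T. p e \<le> t}"
proof (cases k)
  case 0
  then show ?thesis using assms by (simp add: order_statistic_def)
next
  case (Suc k')
  define xs where "xs = sorted_list_of_multiset (image_mset p (mset_set T))"
  have len: "length xs = card T"
    by (metis xs_def mset_sorted_list_of_multiset size_image_mset size_mset size_mset_set)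
  have "length (filter (\<lambda>x. x \<le> t) xs) = size (filter_mset (\<lambda>x. x \<le> t) (mset xs))"
    by (metis mset_filter size_mset)
  also have "\<dots> = card {e \<in> T. p e \<le> t}"
    by (simp add: xs_def filter_mset_image_mset filter_mset_mset_set assms)
  finally have "xs ! k' \<le> t \<longleftrightarrow> k' < card {e \<in> T. p e \<le> t}"
    using sorted_nth_le_iff[of xs k' t] len Suc assms by (simp add: xs_def)
  then show ?thesis by (simp add: order_statistic_def Suc xs_def Suc_le_eq)
qed

lemma bh_count_eq:
  assumes "finite T" "0 \<le> \<alpha>"
  shows "bh_count \<alpha> p T =
    Max {k. k \<le> card T \<and> k \<le> card {e \<in> T. p e \<le> \<alpha> * real k / real (card T)}}"
proof -
  have "order_statistic p T k \<le> \<alpha> * real k / real (card T) \<longleftrightarrow>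
      k \<le> card {e \<in> T. p e \<le> \<alpha> * real k / real (card T)}" if "k \<le> card T" for k
    using order_statistic_le_iff[OF assms(1) that] assms(2) by simp
  then show ?thesis
    unfolding bh_count_def by (intro arg_cong[where f=Max]) blast
qed

lemma bh_count_le_card:
  assumes "finite T" "0 \<le> \<alpha>"
  shows "bh_count \<alpha> p T \<le> card (benjamini_hochberg \<alpha> p T)"
proof -
  let ?K = "{k. k \<le> card T \<and> k \<le> card {e \<in> T. p e \<le> \<alpha> * real k / real (card T)}}"
  have "finite ?K" "0 \<in> ?K" by auto
  then have "bh_count \<alpha> p T \<in> ?K" unfolding bh_count_eq[OF assms] by (intro Max_in) auto
  then show ?thesis by (simp add: benjamini_hochberg_def)
qed

lemma bh_count_mono:
  assumes "finite T" "finite T'" "card T = card T'" "0 \<le> \<alpha>"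
    and le: "\<And>t. card {e \<in> T. p e \<le> t} \<le> card {e \<in> T'. p' e \<le> t}"
  shows "bh_count \<alpha> p T \<le> bh_count \<alpha> p' T'"
  unfolding bh_count_eq[OF assms(1,4)] bh_count_eq[OF assms(2,4)]
proof (rule Max_mono)
  show "{k. k \<le> card T \<and> k \<le> card {e \<in> T. p e \<le> \<alpha> * real k / real (card T)}} \<subseteq>
    {k. k \<le> card T' \<and> k \<le> card {e \<in> T'. p' e \<le> \<alpha> * real k / real (card T')}}"
    unfolding assms(3) using le order_trans by blast
  show "{k. k \<le> card T \<and> k \<le> card {e \<in> T. p e \<le> \<alpha> * real k / real (card T)}} \<noteq> {}"
    by (auto intro: exI[of _ 0])
qed auto

section \<open>False discovery proportion under a uniformly drawn calibration set\<close>

lemma conformal_pvalue_pos: "0 < conformal_pvalue S l C e"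
proof -
  have "0 \<le> (\<Sum>c\<in>C. of_bool (entry S e \<le> entry S c) :: real)" by (intro sum_nonneg) simp
  then show ?thesis unfolding conformal_pvalue_def by (intro divide_pos_pos) linarith+
qed

lemma conformal_pvalue_remove:
  assumes "finite B" "e \<in> B"
  shows "conformal_pvalue S l (B - {e}) f =
    (real (card {c \<in> B. entry S f \<le> entry S c}) + of_bool (entry S e < entry S f)) / (real l + 1)"
proof -
  have "real (card {c \<in> B. entry S f \<le> entry S c}) = (\<Sum>c\<in>B. of_bool (entry S f \<le> entry S c))"
    using assms by (simp add: Int_def)
  also have "\<dots> = of_bool (entry S f \<le> entry S e) + (\<Sum>c\<in>B - {e}. of_bool (entry S f \<le> entry S c))"
    by (rule sum.remove[OF assms])
  finally have "(\<Sum>c\<in>B - {e}. of_bool (entry S f \<le> entry S c)) =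
      real (card {c \<in> B. entry S f \<le> entry S c}) - of_bool (entry S f \<le> entry S e)"
    by simp
  then show ?thesis
    unfolding conformal_pvalue_def by (auto simp: not_le)
qed

text \<open>Fix a set \<open>B\<close> of which all elements but one calibrate the \<open>p\<close>-values. As the score of the
  element \<open>e\<close> that is left out decreases, no \<open>p\<close>-value decreases: the one of \<open>e\<close> is proportional to
  the number of elements of \<open>B\<close> with score at least that of \<open>e\<close>, and the one of any \<open>f\<close> outside
  \<open>B\<close> depends on \<open>e\<close> only through the indicator of \<open>entry S e < entry S f\<close>. Hence the number of
  rejections does not increase. Ties between scores are harmless.\<close>

lemma bh_count_leave_one_out_mono:
  fixes S :: "real ^ 'n::finite ^ 'n"
  assumes B: "B \<subseteq> T" and e: "e \<in> B" "e' \<in> B" and le: "entry S e' \<le> entry S e" and \<alpha>: "0 \<le> \<alpha>"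
  shows "bh_count \<alpha> (conformal_pvalue S l (B - {e'})) (T - (B - {e'})) \<le>
    bh_count \<alpha> (conformal_pvalue S l (B - {e})) (T - (B - {e}))"
proof (rule bh_count_mono)
  show "card (T - (B - {e'})) = card (T - (B - {e}))"
    using B e by (subst (1 2) card_Diff_subset) auto
next
  fix t
  define P where "P e = conformal_pvalue S l (B - {e})" for e
  have split: "card {f \<in> T - (B - {x}). P x f \<le> t} = card {f \<in> T - B. P x f \<le> t} + of_bool (P x x \<le> t)"
    if "x \<in> B" for x
  proof -
    have "{f \<in> T - (B - {x}). P x f \<le> t} = {f \<in> T - B. P x f \<le> t} \<union> {f \<in> {x}. P x f \<le> t}"
      using that B by auto
    then have "card {f \<in> T - (B - {x}). P x f \<le> t} =
        card {f \<in> T - B. P x f \<le> t} + card {f \<in> {x}. P x f \<le> t}"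
      using that by (simp only:) (subst card_Un_disjoint, auto)
    moreover have "{f \<in> {x}. P x f \<le> t} = (if P x x \<le> t then {x} else {})" by auto
    ultimately show ?thesis by simp
  qed
  have mono: "P e f \<le> P e' f" for f
    unfolding P_def conformal_pvalue_remove[OF finite e(1)] conformal_pvalue_remove[OF finite e(2)]
    using le by (intro divide_right_mono add_left_mono) auto
  have "P e e \<le> P e' e'"
    unfolding P_def conformal_pvalue_remove[OF finite e(1)] conformal_pvalue_remove[OF finite e(2)]
    using le by (intro divide_right_mono) (auto intro!: card_mono)
  then have "of_bool (P e' e' \<le> t) \<le> (of_bool (P e e \<le> t) :: nat)"
    by auto
  moreover have "card {f \<in> T - B. P e' f \<le> t} \<le> card {f \<in> T - B. P e f \<le> t}"
    using mono order_trans by (intro card_mono) (auto, blast)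
  ultimately show "card {f \<in> T - (B - {e'}). P e' f \<le> t} \<le> card {f \<in> T - (B - {e}). P e f \<le> t}"
    unfolding split[OF e(1)] split[OF e(2)] by linarith
qed (use \<alpha> in auto)

text \<open>With the set \<open>B\<close> of the calibration pairs and one tested null \<open>e\<close> given, \<open>e\<close> is uniform on
  \<open>B\<close>; divided by \<open>card B = Suc l\<close>, the bound says that \<open>e\<close> contributes at most \<open>\<alpha> / m\<close> to the
  false discovery rate, where \<open>m = card T - l\<close> is the number of tests.\<close>

lemma sum_leave_one_out_le:
  fixes S :: "real ^ 'n::finite ^ 'n"
  assumes B: "B \<subseteq> T" "card B = Suc l" and \<alpha>: "0 \<le> \<alpha>"
  defines "p \<equiv> \<lambda>e. conformal_pvalue S l (B - {e})"
    and "U \<equiv> \<lambda>e. T - (B - {e})"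
  shows "(\<Sum>e\<in>B. of_bool (e \<in> benjamini_hochberg \<alpha> (p e) (U e)) / real (bh_count \<alpha> (p e) (U e)))
    \<le> \<alpha> * real (Suc l) / real (card T - l)"
proof -
  define k where "k e = bh_count \<alpha> (p e) (U e)" for e
  define B' where "B' = {e \<in> B. e \<in> benjamini_hochberg \<alpha> (p e) (U e)}"
  have sum_B': "(\<Sum>e\<in>B. of_bool (e \<in> benjamini_hochberg \<alpha> (p e) (U e)) / real (k e)) =
      (\<Sum>e\<in>B'. 1 / real (k e))"
    unfolding B'_def by (intro sum.mono_neutral_cong_right) auto
  have "(\<Sum>e\<in>B'. 1 / real (k e)) \<le> \<alpha> * real (Suc l) / real (card T - l)"
  proof (cases "B' = {}")
    case True
    then show ?thesis using \<alpha> by simp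
  next
    case False
    \<comment> \<open>The rejected element of least score has the largest \<open>p\<close>-value and the fewest rejections.\<close>
    define e where "e = arg_min_on (entry S) B'"
    have e: "e \<in> B'" "\<And>x. x \<in> B' \<Longrightarrow> entry S e \<le> entry S x"
      using arg_min_if_finite(1)[of B' "entry S"] arg_min_least[of B' _ "entry S"] False
      by (auto simp: e_def)
    then have eB: "e \<in> B" by (simp add: B'_def)
    have card_U: "card (U e) = card T - l"
      using eB B unfolding U_def by (subst card_Diff_subset) auto
    have p_le: "p e e \<le> \<alpha> * real (k e) / real (card T - l)"
      using e(1) by (simp add: B'_def benjamini_hochberg_def k_def card_U)
    have p_eq: "p e e = real (card {c \<in> B. entry S e \<le> entry S c}) / real (Suc l)"
      unfolding p_def conformal_pvalue_remove[OF finite eB] by (simp add: add.commute)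
    have k_pos: "0 < k e"
      using p_le conformal_pvalue_pos[of S l "B - {e}" e] by (cases "k e") (auto simp: p_def)
    have "k e \<le> k x" if "x \<in> B'" for x
      using bh_count_leave_one_out_mono[OF B(1) _ eB e(2)[OF that] \<alpha>] that
      by (simp add: k_def p_def U_def B'_def)
    then have "(\<Sum>x\<in>B'. 1 / real (k x)) \<le> (\<Sum>x\<in>B'. 1 / real (k e))"
      using k_pos by (intro sum_mono divide_left_mono) (auto intro: mult_pos_pos simp: less_le_trans)
    also have "\<dots> = real (card B') / real (k e)" by simp
    also have "\<dots> \<le> real (card {c \<in> B. entry S e \<le> entry S c}) / real (k e)"
      using e(2) by (intro divide_right_mono) (auto simp: B'_def intro!: card_mono)
    also have "\<dots> = p e e * real (Suc l) / real (k e)" unfolding p_eq by simp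
    also have "\<dots> \<le> (\<alpha> * real (k e) / real (card T - l)) * real (Suc l) / real (k e)"
      using p_le by (intro divide_right_mono mult_right_mono) auto
    also have "\<dots> = \<alpha> * real (Suc l) / real (card T - l)" using k_pos by simp
    finally show ?thesis .
  qed
  then show ?thesis using sum_B' by (simp add: k_def)
qed

lemma sum_subsets_swap:
  fixes F :: "'e set \<Rightarrow> 'e \<Rightarrow> 'b::comm_monoid_add"
  assumes "finite A"
  shows "(\<Sum>C | C \<subseteq> A \<and> card C = l. \<Sum>e\<in>A - C. F C e) =
    (\<Sum>B | B \<subseteq> A \<and> card B = Suc l. \<Sum>e\<in>B. F (B - {e}) e)"
proof -
  have fin: "finite {C. C \<subseteq> A \<and> card C = k}" for k using assms by simp
  have "(\<Sum>C | C \<subseteq> A \<and> card C = l. \<Sum>e\<in>A - C. F C e) =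
      (\<Sum>(C, e)\<in>(SIGMA C:{C. C \<subseteq> A \<and> card C = l}. A - C). F C e)"
    using assms fin by (intro sum.Sigma) auto
  also have "\<dots> = (\<Sum>(B, e)\<in>(SIGMA B:{B. B \<subseteq> A \<and> card B = Suc l}. B). F (B - {e}) e)"
    using assms
    by (intro sum.reindex_bij_witness[where i="\<lambda>(B, e). (B - {e}, e)" and j="\<lambda>(C, e). (insert e C, e)"])
       (auto intro: card_Diff_singleton finite_subset simp: card_insert_if finite_subset insert_absorb)
  also have "\<dots> = (\<Sum>B | B \<subseteq> A \<and> card B = Suc l. \<Sum>e\<in>B. F (B - {e}) e)"
    using assms fin by (intro sum.Sigma[symmetric]) (auto intro: finite_subset)
  finally show ?thesis .
qed

lemma FDP_benjamini_hochberg_le: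
  assumes "finite T" "finite H0" "0 \<le> \<alpha>" and pos: "\<And>e. 0 < p e"
  shows "FDP H0 (benjamini_hochberg \<alpha> p T) \<le>
    (\<Sum>e\<in>H0. of_bool (e \<in> benjamini_hochberg \<alpha> p T) / real (bh_count \<alpha> p T))"
proof -
  let ?R = "benjamini_hochberg \<alpha> p T"
  have "FDP H0 ?R = (\<Sum>e\<in>H0. of_bool (e \<in> ?R) / real (max 1 (card ?R)))"
    using assms(2) by (simp add: FDP_def Int_def conj_commute flip: sum_divide_distrib)
  also have "\<dots> \<le> (\<Sum>e\<in>H0. of_bool (e \<in> ?R) / real (bh_count \<alpha> p T))"
  proof (rule sum_mono)
    fix e
    show "of_bool (e \<in> ?R) / real (max 1 (card ?R)) \<le> of_bool (e \<in> ?R) / real (bh_count \<alpha> p T)"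
    proof (cases "e \<in> ?R")
      case True
      then have "0 < bh_count \<alpha> p T"
        using pos[of e] by (cases "bh_count \<alpha> p T") (auto simp: benjamini_hochberg_def)
      then show ?thesis
        using bh_count_le_card[OF assms(1,3), of p]
        by (intro divide_left_mono) (auto intro!: mult_pos_pos)
    qed simp
  qed
  finally show ?thesis .
qed

text \<open>Finite-sample control: with the scores fixed and the calibration set uniform among the subsets
  of size \<open>l\<close> of the exchangeable set \<open>N\<close>, the average false discovery proportion is at most
  \<open>\<alpha>\<close>. A calibration set \<open>C\<close> with a tested null \<open>e\<close> is the same as the set \<open>B = insert e C\<close> with
  the distinguished element \<open>e\<close>.\<close>

lemma sum_FDP_calibration_le:
  fixes S :: "real ^ 'n::finite ^ 'n"
  assumes N: "N \<subseteq> T" and \<alpha>: "0 \<le> \<alpha>"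
  shows "(\<Sum>C | C \<subseteq> N \<and> card C = l.
      FDP (N - C) (benjamini_hochberg \<alpha> (conformal_pvalue S l C) (T - C)) - \<alpha>) \<le> 0"
proof -
  define F where "F C e =
    of_bool (e \<in> benjamini_hochberg \<alpha> (conformal_pvalue S l C) (T - C)) /
      real (bh_count \<alpha> (conformal_pvalue S l C) (T - C))" for C e
  let ?m = "card T - l"
  have "(\<Sum>C | C \<subseteq> N \<and> card C = l. FDP (N - C) (benjamini_hochberg \<alpha> (conformal_pvalue S l C) (T - C)))
      \<le> (\<Sum>C | C \<subseteq> N \<and> card C = l. \<Sum>e\<in>N - C. F C e)"
    unfolding F_def by (intro sum_mono FDP_benjamini_hochberg_le \<alpha> conformal_pvalue_pos) auto
  also have "\<dots> = (\<Sum>B | B \<subseteq> N \<and> card B = Suc l. \<Sum>e\<in>B. F (B - {e}) e)"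
    by (rule sum_subsets_swap) simp
  also have "\<dots> \<le> (\<Sum>B | B \<subseteq> N \<and> card B = Suc l. \<Sum>e\<in>B. \<alpha> / real ?m)"
  proof (rule sum_mono)
    fix B assume "B \<in> {B. B \<subseteq> N \<and> card B = Suc l}"
    then show "(\<Sum>e\<in>B. F (B - {e}) e) \<le> (\<Sum>e\<in>B. \<alpha> / real ?m)"
      using sum_leave_one_out_le[of B T l \<alpha> S] N \<alpha> by (auto simp: F_def mult.commute)
  qed
  also have "\<dots> = (\<Sum>C | C \<subseteq> N \<and> card C = l. \<Sum>e\<in>N - C. \<alpha> / real ?m)"
    by (rule sum_subsets_swap[symmetric]) simp
  also have "\<dots> \<le> (\<Sum>C | C \<subseteq> N \<and> card C = l. \<alpha>)"
  proof (rule sum_mono)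
    fix C assume C: "C \<in> {C. C \<subseteq> N \<and> card C = l}"
    have "card (N - C) \<le> ?m"
      using C card_mono[OF finite N] by (auto simp: card_Diff_subset)
    then have "real (card (N - C)) / real ?m \<le> 1"
      by (auto simp: divide_le_eq_1)
    then show "(\<Sum>e\<in>N - C. \<alpha> / real ?m) \<le> \<alpha>"
      using mult_left_mono[of "real (card (N - C)) / real ?m" 1 \<alpha>] \<alpha> by (simp add: mult.commute)
  qed
  finally show ?thesis by (simp add: sum_subtractf)
qed

section \<open>Exchangeability of the calibration pairs and the unobserved null pairs\<close>

lemma mat_eq_iff_entry: "a = b \<longleftrightarrow> (\<forall>e. entry a e = entry b e)"
  by (auto simp: entry_def vec_eq_iff)

lemma binary_matrices_iff: "a \<in> binary_matrices \<longleftrightarrow> (\<forall>e. entry a e = 0 \<or> entry a e = 1)"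
  by (auto simp: binary_matrices_def entry_def)

lemma binary_matricesD: "a \<in> binary_matrices \<Longrightarrow> entry a e = 0 \<or> entry a e = 1"
  unfolding binary_matrices_iff by blast

lemma finite_binary_matrices: "finite (binary_matrices :: (nat ^ 'm::finite ^ 'n::finite) set)"
proof -
  have "binary_matrices \<subseteq>
      range (\<lambda>E. (\<chi> i j. of_bool ((i, j) \<in> E)) :: nat ^ 'm ^ 'n)"
  proof
    fix a :: "nat ^ 'm ^ 'n" assume "a \<in> binary_matrices"
    then have "a = (\<chi> i j. of_bool ((i, j) \<in> {e. entry a e = 1}))"
      by (auto simp: vec_eq_iff entry_def binary_matrices_def)
    then show "a \<in> range (\<lambda>E. (\<chi> i j. of_bool ((i, j) \<in> E)) :: nat ^ 'm ^ 'n)" by blast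
  qed
  then show ?thesis by (rule finite_subset) simp
qed

text \<open>The sampling matrix in which the pairs of \<open>C\<close> are sampled in addition to those of \<open>t\<close>. If
  \<open>t\<close> samples no pair of \<open>C\<close>, then removing \<open>C\<close> as a calibration set gives back \<open>t\<close>.\<close>

definition add_sampled :: "nat ^ 'n ^ 'n \<Rightarrow> ('n \<times> 'n) set \<Rightarrow> nat ^ 'n ^ 'n" where
  "add_sampled t C = (\<chi> i j. if (i, j) \<in> C then 1 else t $ i $ j)"

lemma entry_add_sampled: "entry (add_sampled t C) e = (if e \<in> C then 1 else entry t e)"
  by (cases e) (simp add: add_sampled_def entry_def)

lemma entry_train_sampling: "entry (train_sampling t C) e = (if e \<in> C then 0 else entry t e)"
  by (cases e) (simp add: train_sampling_def entry_def)

lemma entry_observed_adjacency: "entry (observed_adjacency t a) e = entry t e * entry a e"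
  by (simp add: observed_adjacency_def entry_def)

lemmas sampling_simps = entry_add_sampled entry_train_sampling entry_observed_adjacency
  sampled_pairs_def sampled_nonedges_def sampled_edges_def test_nulls_def test_pairs_def

lemma train_sampling_add_sampled:
  "C \<subseteq> test_nulls a t \<Longrightarrow> train_sampling (add_sampled t C) C = t"
  by (auto simp: mat_eq_iff_entry sampling_simps)

lemma add_sampled_train_sampling:
  "C \<subseteq> sampled_nonedges a t \<Longrightarrow> add_sampled (train_sampling t C) C = t"
  by (auto simp: mat_eq_iff_entry sampling_simps)

lemma train_sampling_binary: "t \<in> binary_matrices \<Longrightarrow> train_sampling t C \<in> binary_matrices"
  by (simp add: binary_matrices_iff sampling_simps)

lemma add_sampled_binary: "t \<in> binary_matrices \<Longrightarrow> add_sampled t C \<in> binary_matrices"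
  by (simp add: binary_matrices_iff sampling_simps)

lemma observed_adjacency_binary:
  "t \<in> binary_matrices \<Longrightarrow> a \<in> binary_matrices \<Longrightarrow> observed_adjacency t a \<in> binary_matrices"
  unfolding binary_matrices_iff sampling_simps by (metis mult_1 mult_zero_left)

lemma calibration_pairs_train_sampling:
  "C \<subseteq> sampled_nonedges a t \<Longrightarrow> C \<subseteq> test_nulls a (train_sampling t C)"
  by (auto simp: sampling_simps)

text \<open>Sampling some unobserved null pairs changes neither the observed adjacency matrix nor the set
  of sampled edges.\<close>

lemma add_sampled_nulls:
  assumes "C \<subseteq> test_nulls a t"
  shows "observed_adjacency (add_sampled t C) a = observed_adjacency t a"
    and "sampled_edges a (add_sampled t C) = sampled_edges a t"
    and "sampled_nonedges a (add_sampled t C) = sampled_nonedges a t \<union> C"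
    and "sampled_nonedges a t \<inter> C = {}"
    and "test_nulls a (add_sampled t C) = test_nulls a t - C"
    and "test_pairs (add_sampled t C) = test_pairs t - C"
  using assms by (auto simp: mat_eq_iff_entry sampling_simps)

text \<open>The probability that the pair \<open>e\<close> is sampled when the true adjacency matrix is \<open>a\<close>.\<close>

definition sampling_rate :: "real \<Rightarrow> real \<Rightarrow> nat ^ 'n ^ 'n \<Rightarrow> 'n \<times> 'n \<Rightarrow> real" where
  "sampling_rate w0 w1 a e = w0 * of_bool (entry a e = 0) + w1 * of_bool (entry a e = 1)"

text \<open>The probability that the sampling matrix equals \<open>t\<close> when the true adjacency matrix is \<open>a\<close>.\<close>

definition sampling_prob ::
  "real \<Rightarrow> real \<Rightarrow> nat ^ 'n ^ 'n \<Rightarrow> nat ^ 'n ^ 'n \<Rightarrow> real" where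
  "sampling_prob w0 w1 a t =
    (\<Prod>e\<in>UNIV. if entry t e = 1 then sampling_rate w0 w1 a e else 1 - sampling_rate w0 w1 a e)"

lemma sampling_prob_nonneg:
  assumes "w0 \<in> {0..1}" "w1 \<in> {0..1}"
  shows "0 \<le> sampling_prob w0 w1 a t"
  unfolding sampling_prob_def using assms by (intro prod_nonneg) (auto simp: sampling_rate_def)

text \<open>All null pairs are sampled with the same probability, so that sampling additional null pairs
  has a probability that depends on their number only.\<close>

lemma sampling_prob_add_sampled:
  fixes a t :: "nat ^ 'n::finite ^ 'n"
  assumes "C \<subseteq> test_nulls a t" "C' \<subseteq> test_nulls a t" "card C = card C'"
  shows "sampling_prob w0 w1 a (add_sampled t C) = sampling_prob w0 w1 a (add_sampled t C')"
proof -
  define r where "r t e = (if entry t e = 1 then sampling_rate w0 w1 a e else 1 - sampling_rate w0 w1 a e)"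
    for t :: "nat ^ 'n ^ 'n" and e
  define N where "N = test_nulls a t"
  have "sampling_prob w0 w1 a (add_sampled t D) =
      w0 ^ card D * (1 - w0) ^ (card N - card D) * (\<Prod>e\<in>-N. r t e)" if D: "D \<subseteq> N" for D
  proof -
    have "(\<Prod>e\<in>D. r (add_sampled t D) e) = (\<Prod>e\<in>D. w0)"
      using D by (intro prod.cong) (auto simp: r_def N_def sampling_simps sampling_rate_def)
    moreover have "(\<Prod>e\<in>N - D. r (add_sampled t D) e) = (\<Prod>e\<in>N - D. 1 - w0)"
      by (intro prod.cong) (auto simp: r_def N_def sampling_simps sampling_rate_def)
    moreover have "(\<Prod>e\<in>-N. r (add_sampled t D) e) = (\<Prod>e\<in>-N. r t e)"
      using D by (intro prod.cong) (auto simp: r_def sampling_simps)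
    moreover have "(\<Prod>e\<in>UNIV. r (add_sampled t D) e) =
        (\<Prod>e\<in>N. r (add_sampled t D) e) * (\<Prod>e\<in>-N. r (add_sampled t D) e)"
      by (subst prod.union_disjoint[symmetric]) auto
    moreover have "(\<Prod>e\<in>N. r (add_sampled t D) e) =
        (\<Prod>e\<in>N - D. r (add_sampled t D) e) * (\<Prod>e\<in>D. r (add_sampled t D) e)"
      using D by (intro prod.subset_diff) auto
    moreover have "sampling_prob w0 w1 a (add_sampled t D) = (\<Prod>e\<in>UNIV. r (add_sampled t D) e)"
      by (simp add: sampling_prob_def r_def)
    ultimately show ?thesis
      using D by (simp add: card_Diff_subset mult.commute)
  qed
  from this[of C] this[of C'] show ?thesis using assms by (simp add: N_def)
qed

text \<open>For a fixed true graph \<open>a\<close> and fixed covariates, which enter only through \<open>S\<close>, the sum over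
  the sampling matrix \<open>t\<close> and the calibration set \<open>C\<close> is grouped by \<open>s = train_sampling t C\<close> and
  \<open>j = card C\<close>. In each group the weight and the scores are constant, and \<open>C\<close> ranges over all
  subsets of size \<open>j\<close> of the nulls left unsampled by \<open>s\<close>.\<close>

lemma sum_FDP_sampling_le:
  fixes a :: "nat ^ 'n::finite ^ 'n"
    and S :: "nat ^ 'n ^ 'n \<Rightarrow> nat ^ 'n ^ 'n \<Rightarrow> real ^ 'n ^ 'n"
    and L :: "nat \<Rightarrow> ('n \<times> 'n) set \<Rightarrow> nat"
  assumes w: "w0 \<in> {0..1}" "w1 \<in> {0..1}" and \<alpha>: "0 \<le> \<alpha>"
  defines "D0 \<equiv> sampled_nonedges a" and "D1 \<equiv> sampled_edges a"
  shows "(\<Sum>t\<in>binary_matrices. \<Sum>C | C \<subseteq> D0 t \<and> card C = L (card (D0 t)) (D1 t).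
      sampling_prob w0 w1 a t / real (card (D0 t) choose card C) *
      (FDP (test_nulls a t)
        (benjamini_hochberg \<alpha>
          (conformal_pvalue (S (observed_adjacency t a) (train_sampling t C)) (card C) C)
          (test_pairs t)) - \<alpha>)) \<le> 0"
proof -
  define G where "G t C = sampling_prob w0 w1 a t / real (card (D0 t) choose card C) *
      (FDP (test_nulls a t)
        (benjamini_hochberg \<alpha>
          (conformal_pvalue (S (observed_adjacency t a) (train_sampling t C)) (card C) C)
          (test_pairs t)) - \<alpha>)" for t C
  define I where "I t = {C. C \<subseteq> D0 t \<and> card C = L (card (D0 t)) (D1 t)}" for t
  define J where "J = {(t, j). t \<in> binary_matrices \<and> j \<le> CARD('n \<times> 'n) \<and> j = L (card (D0 t) + j) (D1 t)}"
  define Cs where "Cs = (\<lambda>(t, j). {C. C \<subseteq> test_nulls a t \<and> card C = j})"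
  have "J \<subseteq> binary_matrices \<times> {..CARD('n \<times> 'n)}" by (auto simp: J_def)
  then have finJ: "finite J"
    by (rule finite_subset) (simp add: finite_binary_matrices)
  have card_add: "card (D0 (add_sampled t C)) = card (D0 t) + card C" if "C \<subseteq> test_nulls a t" for t C
    using add_sampled_nulls[OF that] by (simp add: D0_def card_Un_disjoint)
  have "(\<Sum>t\<in>binary_matrices. \<Sum>C\<in>I t. G t C) = (\<Sum>(t, C)\<in>Sigma binary_matrices I. G t C)"
    by (intro sum.Sigma) (auto simp: finite_binary_matrices)
  also have "\<dots> = (\<Sum>(x, C)\<in>Sigma J Cs. G (add_sampled (fst x) C) C)"
  proof (rule sum.reindex_bij_witness[where i="\<lambda>(x, C). (add_sampled (fst x) C, C)"
        and j="\<lambda>(t, C). ((train_sampling t C, card C), C)"])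
    fix p assume p: "p \<in> Sigma binary_matrices I"
    obtain t C where pe: "p = (t, C)" by (cases p)
    let ?s = "train_sampling t C"
    have t: "t \<in> binary_matrices" and C: "C \<subseteq> sampled_nonedges a t" "card C = L (card (D0 t)) (D1 t)"
      using p by (auto simp: pe I_def D0_def)
    have ts: "add_sampled ?s C = t" by (rule add_sampled_train_sampling[OF C(1)])
    have Cs: "C \<subseteq> test_nulls a ?s" by (rule calibration_pairs_train_sampling[OF C(1)])
    have "card C \<le> CARD('n \<times> 'n)" by (rule card_mono) auto
    show "(case case p of (t, C) \<Rightarrow> ((train_sampling t C, card C), C) of
         (x, C) \<Rightarrow> (add_sampled (fst x) C, C)) = p"
      by (simp add: pe ts)
    show "(case p of (t, C) \<Rightarrow> ((train_sampling t C, card C), C)) \<in> Sigma J Cs"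
      using card_add[OF Cs] add_sampled_nulls(2)[OF Cs] C Cs train_sampling_binary[OF t]
        \<open>card C \<le> CARD('n \<times> 'n)\<close>
      by (simp add: pe J_def Cs_def ts D1_def)
    show "(case case p of (t, C) \<Rightarrow> ((train_sampling t C, card C), C) of
         (x, C) \<Rightarrow> G (add_sampled (fst x) C) C) = (case p of (t, C) \<Rightarrow> G t C)"
      by (simp add: pe ts)
  next
    fix p assume p: "p \<in> Sigma J Cs"
    obtain t j C where pe: "p = ((t, j), C)" by (metis prod.collapse)
    have t: "t \<in> binary_matrices" and j: "j = card C" and C: "C \<subseteq> test_nulls a t"
      and L: "card C = L (card (D0 t) + card C) (D1 t)"
      using p by (auto simp: pe J_def Cs_def)
    show "(case case p of (x, C) \<Rightarrow> (add_sampled (fst x) C, C) of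
         (t, C) \<Rightarrow> ((train_sampling t C, card C), C)) = p"
      by (simp add: pe j train_sampling_add_sampled[OF C])
    show "(case p of (x, C) \<Rightarrow> (add_sampled (fst x) C, C)) \<in> Sigma binary_matrices I"
      using L add_sampled_nulls(2,3)[OF C] card_add[OF C] add_sampled_binary[OF t]
      by (simp add: pe I_def D1_def) (simp add: D0_def)
  qed
  also have "\<dots> = (\<Sum>x\<in>J. \<Sum>C\<in>Cs x. G (add_sampled (fst x) C) C)"
    using finJ by (intro sum.Sigma[symmetric]) auto
  also have "\<dots> \<le> (\<Sum>x\<in>J. 0)"
  proof (rule sum_mono)
    fix x assume "x \<in> J"
    obtain t j where x: "x = (t, j)" by (cases x)
    show "(\<Sum>C\<in>Cs x. G (add_sampled (fst x) C) C) \<le> 0"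
    proof (cases "Cs x = {}")
      case False
      then obtain C' where C': "C' \<subseteq> test_nulls a t" "card C' = j"
        by (auto simp: x Cs_def)
      define v where "v = sampling_prob w0 w1 a (add_sampled t C') / real (card (D0 t) + j choose j)"
      let ?p = "\<lambda>C. conformal_pvalue (S (observed_adjacency t a) t) j C"
      have "G (add_sampled t C) C =
          v * (FDP (test_nulls a t - C) (benjamini_hochberg \<alpha> (?p C) (test_pairs t - C)) - \<alpha>)"
        if C: "C \<subseteq> test_nulls a t" "card C = j" for C
        using sampling_prob_add_sampled[OF C(1) C'(1)] C C'(2)
        by (simp add: G_def v_def card_add add_sampled_nulls[OF C(1)] train_sampling_add_sampled[OF C(1)])
      then have "(\<Sum>C\<in>Cs x. G (add_sampled (fst x) C) C) = v * (\<Sum>C\<in>Cs x.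
          FDP (test_nulls a t - C) (benjamini_hochberg \<alpha> (?p C) (test_pairs t - C)) - \<alpha>)"
        unfolding sum_distrib_left by (intro sum.cong) (auto simp: x Cs_def)
      also have "\<dots> \<le> 0"
      proof (rule mult_nonneg_nonpos)
        show "0 \<le> v" unfolding v_def by (intro divide_nonneg_nonneg sampling_prob_nonneg w) simp
        have "test_nulls a t \<subseteq> test_pairs t" by (auto simp: sampling_simps)
        then show "(\<Sum>C\<in>Cs x.
            FDP (test_nulls a t - C) (benjamini_hochberg \<alpha> (?p C) (test_pairs t - C)) - \<alpha>) \<le> 0"
          unfolding x Cs_def prod.case by (rule sum_FDP_calibration_le) (fact \<alpha>)
      qed
      finally show ?thesis .
    qed simp
  qed
  finally show ?thesis by (simp add: I_def G_def)
qed

section \<open>Disintegration of the law of the data\<close>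

lemma generated_algebra_subalgebra:
  assumes "finite_measure M" "Y \<in> measurable M N"
  shows "finite_measure_subalgebra M (generated_algebra M N Y)"
proof -
  interpret finite_measure M by fact
  show ?thesis
    using sets_image_in_sets[OF refl assms(2)]
    by unfold_locales (simp add: subalgebra_def generated_algebra_def)
qed

lemma measurable_generated_algebra:
  assumes "Y \<in> measurable M N" "f \<in> measurable N L"
  shows "(\<lambda>w. f (Y w)) \<in> measurable (generated_algebra M N Y) L"
  unfolding generated_algebra_def
  using measurable_compose[OF measurable_vimage_algebra1 assms(2)] assms(1)
  by (auto simp: measurable_def)

text \<open>The conditional probability of \<open>E\<close> need be known only where the \<open>F\<close>-measurable factor \<open>Y\<close>
  does not vanish.\<close>

lemma (in finite_measure_subalgebra) integral_mult_indicator_cond_prob: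
  fixes Y :: "'a \<Rightarrow> real"
  assumes Y: "Y \<in> borel_measurable F" and bound: "\<And>w. w \<in> space M \<Longrightarrow> \<bar>Y w\<bar> \<le> b" and E: "E \<in> sets M"
    and V: "AE w in M. cond_prob_given M F E w = V w"
    and c: "\<And>w. w \<in> space M \<Longrightarrow> Y w \<noteq> 0 \<Longrightarrow> V w = c"
  shows "(\<integral>w. Y w * indicator E w \<partial>M) = c * (\<integral>w. Y w \<partial>M)"
proof -
  have Y_M: "Y \<in> borel_measurable M" by (rule measurable_from_subalg[OF subalg Y])
  have "integrable M (\<lambda>w. Y w * indicator E w)"
    using bound Y_M E
    by (intro integrable_const_bound[where B="\<bar>b\<bar>"] AE_I2) (force split: split_indicator)+
  then have "(\<integral>w. Y w * indicator E w \<partial>M) = (\<integral>w. Y w * real_cond_exp M F (indicator E) w \<partial>M)"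
    using Y E by (intro real_cond_exp_intg(2)[symmetric]) auto
  also have "\<dots> = (\<integral>w. c * Y w \<partial>M)"
  proof (rule integral_cong_AE)
    show "AE w in M. Y w * real_cond_exp M F (indicator E) w = c * Y w"
      using V AE_space
    proof eventually_elim
      case (elim w)
      then show ?case using c[of w] by (cases "Y w = 0") (auto simp: cond_prob_given_def)
    qed
  qed (use Y_M in \<open>auto intro: borel_measurable_cond_exp2\<close>)
  finally show ?thesis by simp
qed

lemma (in finite_measure_subalgebra) cond_prob_given_Compl:
  assumes "E \<in> sets M"
  shows "AE w in M. cond_prob_given M F (space M - E) w = 1 - cond_prob_given M F E w"
proof -
  have "AE w in M. real_cond_exp M F (\<lambda>w. 1 - indicator E w) w =
      real_cond_exp M F (\<lambda>_. 1) w - real_cond_exp M F (indicator E) w"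
    using assms by (intro real_cond_exp_diff) (auto simp: emeasure_eq_measure)
  moreover have "AE w in M. real_cond_exp M F (\<lambda>_. 1) w = 1"
    by (intro real_cond_exp_F_meas) auto
  moreover have "AE w in M. real_cond_exp M F (indicator (space M - E)) w =
      real_cond_exp M F (\<lambda>w. 1 - indicator E w) w"
    using assms by (intro real_cond_exp_cong) (auto split: split_indicator)
  ultimately show ?thesis
    unfolding cond_prob_given_def by eventually_elim simp
qed

lemma cond_prob_sampling_matrix:
  fixes Astar Om :: "'w \<Rightarrow> nat ^ 'n::finite ^ 'n"
  assumes F: "finite_measure_subalgebra M F"
    and Om_rv: "Om \<in> measurable M (count_space binary_matrices)"
    and indep: "cond_indep_vars M F (\<lambda>_. count_space UNIV) (\<lambda>e w. entry (Om w) e) UNIV"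
    and bernoulli: "\<And>e. AE w in M.
      cond_prob_given M F {w \<in> space M. entry (Om w) e = 1} w = sampling_rate w0 w1 (Astar w) e"
    and t: "t \<in> binary_matrices"
  shows "AE w in M. cond_prob_given M F {w \<in> space M. Om w = t} w = sampling_prob w0 w1 (Astar w) t"
proof -
  interpret finite_measure_subalgebra M F by fact
  let ?E = "\<lambda>e. (\<lambda>w. entry (Om w) e) -` {entry t e} \<inter> space M"
  have "AE w in M. cond_prob_given M F (?E e) w =
      (if entry t e = 1 then sampling_rate w0 w1 (Astar w) e
       else 1 - sampling_rate w0 w1 (Astar w) e)" for e
  proof (cases "entry t e = 1")
    case True
    then have "?E e = {w \<in> space M. entry (Om w) e = 1}" by auto
    then show ?thesis using bernoulli[of e] True by simp
  next
    case False
    then have t0: "entry t e = 0" using binary_matricesD[OF t, of e] by simp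
    have "entry (Om w) e = 0 \<or> entry (Om w) e = 1" if "w \<in> space M" for w
      using that measurable_space[OF Om_rv, of w] by (auto dest: binary_matricesD)
    then have E: "?E e = space M - {w \<in> space M. entry (Om w) e = 1}"
      using t0 by auto
    have "(\<lambda>w. entry (Om w) e) \<in> measurable M (count_space UNIV)"
      by (rule measurable_compose[OF Om_rv]) simp
    then have "{w \<in> space M. entry (Om w) e = 1} \<in> sets M" by measurable
    from cond_prob_given_Compl[OF this] bernoulli[of e] show ?thesis
      unfolding E by eventually_elim (simp add: t0)
  qed
  then have factors: "AE w in M. \<forall>e. cond_prob_given M F (?E e) w =
      (if entry t e = 1 then sampling_rate w0 w1 (Astar w) e
       else 1 - sampling_rate w0 w1 (Astar w) e)"
    by (simp add: AE_all_countable)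
  have product: "AE w in M. cond_prob_given M F (\<Inter>e\<in>UNIV. ?E e) w =
      (\<Prod>e\<in>UNIV. cond_prob_given M F (?E e) w)"
    using indep unfolding cond_indep_vars_def by fastforce
  have "(\<Inter>e\<in>UNIV. ?E e) = {w \<in> space M. Om w = t}"
    by (auto simp: mat_eq_iff_entry)
  note product[unfolded this]
  with factors show ?thesis
    unfolding sampling_prob_def by eventually_elim (simp only:)
qed

text \<open>A function of the scores that depends on their order only is measurable.\<close>

lemma measurable_entry_order:
  fixes G :: "'x \<Rightarrow> real ^ 'n::finite ^ 'm::finite"
  assumes G: "G \<in> borel_measurable N"
    and f: "\<And>S S'. (\<And>e c. entry S e \<le> entry S c \<longleftrightarrow> entry S' e \<le> entry S' c) \<Longrightarrow> f S = f S'"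
  shows "(\<lambda>x. f (G x)) \<in> measurable N (count_space UNIV)"
proof -
  define R where "R S = {(e, c). entry S e \<le> entry S c}" for S :: "real ^ 'n ^ 'm"
  have entry_G: "(\<lambda>x. entry (G x) e) \<in> borel_measurable N" for e
    unfolding entry_def
    by (intro borel_measurable_continuous_on[where f="\<lambda>v. v $ fst e $ snd e", OF _ G]
        continuous_intros)
  have R_G: "(\<lambda>x. R (G x)) \<in> measurable N (count_space UNIV)"
  proof (subst measurable_count_space_eq_countable)
    show "countable (UNIV :: (('m \<times> 'n) \<times> ('m \<times> 'n)) set set)"
      by (intro countable_finite) simp
    have "(\<lambda>x. R (G x)) -` {Q} \<inter> space N =
        {x \<in> space N. \<forall>e c. (e, c) \<in> Q \<longleftrightarrow> entry (G x) e \<le> entry (G x) c}" for Q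
      by (auto simp: R_def set_eq_iff)
    moreover have "{x \<in> space N. (e, c) \<in> Q \<longleftrightarrow> entry (G x) e \<le> entry (G x) c} \<in> sets N" for Q e c
      using borel_measurable_le[OF entry_G[of e] entry_G[of c]]
        borel_measurable_less[OF entry_G[of c] entry_G[of e]]
      by (cases "(e, c) \<in> Q") (simp_all add: not_le)
    then have "{x \<in> space N. \<forall>e c. (e, c) \<in> Q \<longleftrightarrow> entry (G x) e \<le> entry (G x) c} \<in> sets N" for Q
      by (intro sets.sets_Collect_countable_All)
    ultimately show "(\<lambda>x. R (G x)) \<in> space N \<rightarrow> UNIV \<and>
        (\<forall>Q\<in>UNIV. (\<lambda>x. R (G x)) -` {Q} \<inter> space N \<in> sets N)" by simp
  qed
  have f_R: "f (SOME S'. R S' = R S) = f S" for S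
  proof (rule f)
    have "R (SOME S'. R S' = R S) = R S" by (rule someI) simp
    then show "entry (SOME S'. R S' = R S) e \<le> entry (SOME S'. R S' = R S) c \<longleftrightarrow>
        entry S e \<le> entry S c" for e c
      unfolding R_def by blast
  qed
  have "(\<lambda>x. (\<lambda>Q. f (SOME S'. R S' = Q)) (R (G x))) \<in> measurable N (count_space UNIV)"
    by (rule measurable_compose[OF R_G]) simp
  then show ?thesis unfolding f_R .
qed

lemma conformal_pvalue_order:
  assumes "\<And>e c. entry S e \<le> entry S c \<longleftrightarrow> entry S' e \<le> entry S' c"
  shows "conformal_pvalue S l C = conformal_pvalue S' l C"
  unfolding conformal_pvalue_def assms ..

lemma FDP_bounds:
  assumes "finite R"
  shows "0 \<le> FDP H0 R" "FDP H0 R \<le> 1"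
proof -
  have "card (R \<inter> H0) \<le> max 1 (card R)"
    using card_mono[OF assms, of "R \<inter> H0"] by auto
  then show "0 \<le> FDP H0 R" "FDP H0 R \<le> 1"
    unfolding FDP_def by (simp_all only: divide_le_eq_1 of_nat_le_iff) auto
qed

text \<open>The calibration set is integrated out conditionally on \<open>(Astar, X, Om)\<close>, then the sampling
  matrix conditionally on \<open>(Astar, X)\<close>.\<close>

lemma integral_fixed_sampling:
  fixes M :: "'w measure"
    and Astar Om :: "'w \<Rightarrow> nat ^ 'n::finite ^ 'n"
    and X :: "'w \<Rightarrow> real ^ 'd::finite ^ 'n"
    and Dcal :: "'w \<Rightarrow> ('n \<times> 'n) set"
    and \<psi> :: "real ^ 'd ^ 'n \<Rightarrow> real"
  defines "G_AX \<equiv> generated_algebra M (count_space binary_matrices \<Otimes>\<^sub>M borel)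
                  (\<lambda>w. (Astar w, X w))"
    and "G_Zstar \<equiv> generated_algebra M obs_space (\<lambda>w. (Astar w, X w, Om w))"
  assumes M: "prob_space M"
    and Astar_rv: "Astar \<in> measurable M (count_space binary_matrices)"
    and X_rv: "X \<in> borel_measurable M"
    and Om_rv: "Om \<in> measurable M (count_space binary_matrices)"
    and Dcal_rv: "Dcal \<in> measurable M (count_space UNIV)"
    and Om_law: "AE w in M. cond_prob_given M G_AX {w \<in> space M. Om w = t} w = q (Astar w)"
    and Dcal_law: "AE w in M. cond_prob_given M G_Zstar {w \<in> space M. Dcal w = C} w = u (Astar w) (Om w)"
    and \<psi>: "\<psi> \<in> borel_measurable borel" "\<And>x. \<bar>\<psi> x\<bar> \<le> b"
  shows "(\<integral>w. \<psi> (X w) * indicator {w \<in> space M. Astar w = a} w * indicator {w \<in> space M. Om w = t} w *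
      indicator {w \<in> space M. Dcal w = C} w \<partial>M) =
    (\<integral>w. q a * u a t * \<psi> (X w) * indicator {w \<in> space M. Astar w = a} w \<partial>M)"
proof -
  interpret prob_space M by fact
  have AX: "(\<lambda>w. (Astar w, X w)) \<in> measurable M (count_space binary_matrices \<Otimes>\<^sub>M borel)"
    using Astar_rv X_rv by (rule measurable_Pair)
  have Zstar: "(\<lambda>w. (Astar w, X w, Om w)) \<in> measurable M obs_space"
    unfolding obs_space_def using Astar_rv X_rv Om_rv by (intro measurable_Pair)
  interpret AX: finite_measure_subalgebra M G_AX
    unfolding G_AX_def by (rule generated_algebra_subalgebra[OF _ AX]) unfold_locales
  interpret Zstar: finite_measure_subalgebra M G_Zstar
    unfolding G_Zstar_def by (rule generated_algebra_subalgebra[OF _ Zstar]) unfold_locales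
  define Y where "Y w = \<psi> (X w) * indicator {w \<in> space M. Astar w = a} w" for w
  define Y' where "Y' w = Y w * indicator {w \<in> space M. Om w = t} w" for w
  have bound: "\<bar>Y w\<bar> \<le> b" "\<bar>Y' w\<bar> \<le> b" if "w \<in> space M" for w
    using \<psi>(2)[of "X w"] by (auto simp: Y_def Y'_def split: split_indicator)
  have ind_a: "(\<lambda>y. indicator {a} y :: real) \<in> borel_measurable (count_space binary_matrices)"
    and ind_t: "(\<lambda>y. indicator {t} y :: real) \<in> borel_measurable (count_space binary_matrices)"
    by simp_all
  have "(\<lambda>(y, x). \<psi> x * indicator {a} y) \<in> borel_measurable (count_space binary_matrices \<Otimes>\<^sub>M borel)"
    using \<psi>(1) ind_a by measurable
  from measurable_generated_algebra[OF AX this]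
  have Y: "Y \<in> borel_measurable G_AX"
    unfolding G_AX_def
    by (rule measurable_cong[THEN iffD1, rotated])
      (auto simp: Y_def generated_algebra_def split: split_indicator)
  have "(\<lambda>(y, x, s). \<psi> x * indicator {a} y * indicator {t} s) \<in> borel_measurable obs_space"
    unfolding obs_space_def using \<psi>(1) ind_a ind_t by measurable
  from measurable_generated_algebra[OF Zstar this]
  have Y': "Y' \<in> borel_measurable G_Zstar"
    unfolding G_Zstar_def
    by (rule measurable_cong[THEN iffD1, rotated])
      (auto simp: Y_def Y'_def generated_algebra_def split: split_indicator)
  have E: "{w \<in> space M. Om w = t} \<in> sets M"
    using measurable_sets[OF measurable_compose[OF Om_rv, of id "count_space UNIV"], of "{t}"]
    by (simp add: vimage_def Int_def conj_commute)
  have D: "{w \<in> space M. Dcal w = C} \<in> sets M"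
    using measurable_sets[OF Dcal_rv, of "{C}"] by (simp add: vimage_def Int_def conj_commute)
  have "(\<integral>w. Y' w * indicator {w \<in> space M. Dcal w = C} w \<partial>M) = u a t * (\<integral>w. Y' w \<partial>M)"
    by (rule Zstar.integral_mult_indicator_cond_prob[OF Y' bound(2) D Dcal_law])
      (auto simp: Y_def Y'_def split: split_indicator_asm)
  also have "(\<integral>w. Y' w \<partial>M) = q a * (\<integral>w. Y w \<partial>M)"
    unfolding Y'_def
    by (rule AX.integral_mult_indicator_cond_prob[OF Y bound(1) E Om_law])
      (auto simp: Y_def split: split_indicator_asm)
  also have "u a t * (q a * (\<integral>w. Y w \<partial>M)) = (\<integral>w. (q a * u a t) * Y w \<partial>M)"
    by (simp add: mult.commute mult.left_commute)
  finally show ?thesis by (simp add: Y_def Y'_def mult.assoc)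
qed

section \<open>Control of the false discovery rate\<close>

lemma pmf_of_subsets_of_card:
  assumes "finite A" "k \<le> card A"
  shows "pmf (pmf_of_set {B. B \<subseteq> A \<and> card B = k}) C =
    of_bool (C \<subseteq> A \<and> card C = k) / real (card A choose k)"
proof -
  have "{B. B \<subseteq> A \<and> card B = k} \<noteq> {}"
    using assms(2) obtain_subset_with_card_n by blast
  then show ?thesis
    using assms by (simp add: n_subsets indicator_def of_bool_def)
qed

theorem theorem1:
  fixes M :: "'w measure"
    and Astar :: "'w \<Rightarrow> nat ^ 'n::finite ^ 'n"
    and X :: "'w \<Rightarrow> real ^ 'd::finite ^ 'n"
    and Om :: "'w \<Rightarrow> nat ^ 'n ^ 'n"
    and Dcal :: "'w \<Rightarrow> ('n \<times> 'n) set"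
    and l :: "'w \<Rightarrow> nat"
    and g :: "('n, 'd) obs \<Rightarrow> real ^ 'n ^ 'n"
    and h :: "('n, 'd) feature \<times> ('n, 'd) labelled_feature set \<Rightarrow> real"
    and w0 w1 \<alpha> :: real
    and K :: nat
  defines "Z \<equiv> \<lambda>w. (observed_adjacency (Om w) (Astar w), X w, Om w)"
    and "D0 \<equiv> \<lambda>w. sampled_nonedges (Astar w) (Om w)"
    and "D1 \<equiv> \<lambda>w. sampled_edges (Astar w) (Om w)"
    and "G_AX \<equiv> generated_algebra M (count_space binary_matrices \<Otimes>\<^sub>M borel)
                  (\<lambda>w. (Astar w, X w))"
    and "G_Zstar \<equiv> generated_algebra M obs_space (\<lambda>w. (Astar w, X w, Om w))"
  assumes prob: "prob_space M"
    and Astar_rv: "Astar \<in> measurable M (count_space binary_matrices)"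
    and X_rv: "X \<in> borel_measurable M"
    and Om_rv: "Om \<in> measurable M (count_space binary_matrices)"
    and w0: "w0 \<in> {0..1}"
    and w1: "w1 \<in> {0..1}"
    and Om_indep: "cond_indep_vars M G_AX (\<lambda>_. count_space UNIV) (\<lambda>e w. entry (Om w) e) UNIV"
    and Om_bernoulli: "\<And>e. AE w in M.
          cond_prob_given M G_AX {w \<in> space M. entry (Om w) e = 1} w =
          w0 * of_bool (entry (Astar w) e = 0) + w1 * of_bool (entry (Astar w) e = 1)"
    and Dcal_rv: "Dcal \<in> measurable M (count_space UNIV)"
    and l_le: "\<And>w. w \<in> space M \<Longrightarrow> l w \<le> card (D0 w)"
    and Dcal_uniform: "\<And>C. AE w in M.
          cond_prob_given M G_Zstar {w \<in> space M. Dcal w = C} w =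
          pmf (pmf_of_set {B. B \<subseteq> D0 w \<and> card B = l w}) C"
    and \<alpha>: "\<alpha> \<in> {0<..<1}"
    and K: "K \<in> {1..CARD('n)}"
    and g_measurable: "g \<in> borel_measurable obs_space"
    and h_measurable:
      "h \<in> borel_measurable (feature_space \<Otimes>\<^sub>M finite_subset_space labelled_feature_space)"
    and g_form: "\<And>a x om i j. (a, x, om) \<in> space obs_space \<Longrightarrow>
          g (a, x, om) $ i $ j =
          h (feature K a x i j, {labelled_feature K a x u v | u v. om $ u $ v = 1})"
    and no_ties: "AE w in M. no_ties (train_scores g (Z w) (Dcal w))"
    and l_function: "\<exists>f. \<forall>w\<in>space M. l w = f (card (D0 w)) (D1 w)"
  shows "prob_space.expectation M
           (\<lambda>w. FDP (test_nulls (Astar w) (Om w))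
                     (conformal_link_prediction \<alpha> g (l w) (Z w) (Dcal w))) \<le> \<alpha>"
proof -
  interpret prob_space M by (fact prob)
  obtain f where f: "l w = f (card (D0 w)) (D1 w)" if "w \<in> space M" for w
    using l_function by blast
  \<comment> \<open>Truncation makes the calibration size admissible for all matrices, not only for those that
    the random matrices attain.\<close>
  define L where "L k D = min (f k D) k" for k D
  define l' where "l' a t = L (card (sampled_nonedges a t)) (sampled_edges a t)" for a t
  have l_eq: "l w = l' (Astar w) (Om w)" if "w \<in> space M" for w
    using f[OF that] l_le[OF that] by (simp add: l'_def L_def D0_def D1_def)
  define u where "u C a t = (of_bool (C \<subseteq> sampled_nonedges a t \<and> card C = l' a t) /
    real (card (sampled_nonedges a t) choose l' a t) :: real)" for C a t
  define \<psi> where "\<psi> a t C x = FDP (test_nulls a t)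
    (conformal_link_prediction \<alpha> g (l' a t) (observed_adjacency t a, x, t) C) - \<alpha>" for a t C x
  define T where "T w = (Astar w, Om w, Dcal w)" for w
  define P where "P = (binary_matrices :: (nat ^ 'n ^ 'n) set) \<times> (binary_matrices :: (nat ^ 'n ^ 'n) set)
    \<times> (UNIV :: ('n \<times> 'n) set set)"
  have finP: "finite P" unfolding P_def by (intro finite_cartesian_product finite_binary_matrices) simp
  have T_P: "T w \<in> P" if "w \<in> space M" for w
    using measurable_space[OF Astar_rv that] measurable_space[OF Om_rv that] by (simp add: T_def P_def)

  have \<psi>_measurable: "\<psi> a t C \<in> borel_measurable borel"
    if "a \<in> binary_matrices" "t \<in> binary_matrices" for a t C
  proof -
    have "(\<lambda>x. (observed_adjacency t a, x, train_sampling t C)) \<in> measurable borel obs_space"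
      unfolding obs_space_def using that observed_adjacency_binary train_sampling_binary
      by (intro measurable_Pair measurable_const) auto
    then have "(\<lambda>x. g (observed_adjacency t a, x, train_sampling t C)) \<in> borel_measurable borel"
      by (rule measurable_compose) (fact g_measurable)
    then have "(\<lambda>x. FDP (test_nulls a t) (benjamini_hochberg \<alpha> (conformal_pvalue
        (g (observed_adjacency t a, x, train_sampling t C)) (l' a t) C) (test_pairs t)))
        \<in> measurable borel (count_space UNIV)"
      by (rule measurable_entry_order) (metis conformal_pvalue_order)
    then show ?thesis
      unfolding \<psi>_def conformal_link_prediction_def train_scores_def prod.case
      by (intro borel_measurable_diff) (auto intro: measurable_compose)
  qed
  have \<psi>_bound: "\<bar>\<psi> a t C x\<bar> \<le> 1" for a t C x
    using FDP_bounds[OF finite, of "test_nulls a t"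
        "conformal_link_prediction \<alpha> g (l' a t) (observed_adjacency t a, x, t) C"] \<alpha>
    by (auto simp: \<psi>_def abs_le_iff)

  have Om_law: "AE w in M. cond_prob_given M G_AX {w \<in> space M. Om w = t} w =
      sampling_prob w0 w1 (Astar w) t" if "t \<in> binary_matrices" for t
    unfolding G_AX_def
    using Om_rv Om_indep Om_bernoulli that Astar_rv X_rv
    by (intro cond_prob_sampling_matrix generated_algebra_subalgebra measurable_Pair)
      (auto simp: G_AX_def sampling_rate_def intro: finite_measure_axioms)
  have Dcal_law: "AE w in M. cond_prob_given M G_Zstar {w \<in> space M. Dcal w = C} w =
      u C (Astar w) (Om w)" for C
    using Dcal_uniform[of C] AE_space
  proof eventually_elim
    case (elim w)
    have "l' (Astar w) (Om w) \<le> card (sampled_nonedges (Astar w) (Om w))"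
      by (simp add: l'_def L_def)
    then show ?case
      using elim by (simp add: l_eq D0_def u_def pmf_of_subsets_of_card)
  qed

  \<comment> \<open>All random elements but the covariates are discrete, so the expectation splits into finitely
    many integrals in which only the covariates vary.\<close>
  let ?at = "\<lambda>a w. indicator {w \<in> space M. Astar w = a} w :: real"
  let ?J = "\<lambda>a t C w. \<psi> a t C (X w) * ?at a w * indicator {w \<in> space M. Om w = t} w *
    indicator {w \<in> space M. Dcal w = C} w"
  have ev: "{w \<in> space M. Astar w = a} \<in> sets M" "{w \<in> space M. Om w = a} \<in> sets M"
    "{w \<in> space M. Dcal w = C} \<in> sets M" for a C
    using measurable_sets[OF measurable_compose[OF Om_rv, of id "count_space UNIV"], of "{a}"]
      measurable_sets[OF measurable_compose[OF Astar_rv, of id "count_space UNIV"], of "{a}"]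
      measurable_sets[OF Dcal_rv, of "{C}"]
    by (simp_all add: vimage_def Int_def conj_commute)
  have \<psi>X: "(\<lambda>w. \<psi> a t C (X w)) \<in> borel_measurable M"
    if "a \<in> binary_matrices" "t \<in> binary_matrices" for a t C
    using measurable_compose[OF X_rv \<psi>_measurable[OF that]] .
  have int_J: "integrable M (?J a t C)" and int_a: "integrable M (\<lambda>w. c * \<psi> a t C (X w) * ?at a w)"
    if "a \<in> binary_matrices" "t \<in> binary_matrices" for a t C c
  proof -
    show "integrable M (?J a t C)"
      using \<psi>X[OF that] ev \<psi>_bound
      by (intro integrable_const_bound[where B=1] AE_I2) (auto split: split_indicator)
    show "integrable M (\<lambda>w. c * \<psi> a t C (X w) * ?at a w)"
      using \<psi>X[OF that] ev \<psi>_bound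
      by (intro integrable_const_bound[where B="\<bar>c\<bar>"] AE_I2)
        (auto split: split_indicator simp: abs_mult mult_left_le)
  qed

  let ?FDP = "\<lambda>w. FDP (test_nulls (Astar w) (Om w)) (conformal_link_prediction \<alpha> g (l w) (Z w) (Dcal w))"
  have split: "?FDP w - \<alpha> = (\<Sum>(a, t, C)\<in>P. ?J a t C w)" if w: "w \<in> space M" for w
  proof -
    have "(\<Sum>(a, t, C)\<in>P. ?J a t C w) = (\<Sum>p\<in>P. if T w = p then case p of (a, t, C) \<Rightarrow> \<psi> a t C (X w) else 0)"
      using w by (intro sum.cong) (auto simp: T_def indicator_def)
    also have "\<dots> = \<psi> (Astar w) (Om w) (Dcal w) (X w)"
      using T_P[OF w] finP by (simp add: T_def)
    finally show ?thesis using w by (simp add: \<psi>_def Z_def l_eq)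
  qed
  have int_sum: "integrable M (\<lambda>w. \<Sum>(a, t, C)\<in>P. ?J a t C w)"
    by (intro Bochner_Integration.integrable_sum) (auto simp: P_def intro: int_J)
  have int_FDP: "integrable M ?FDP"
  proof -
    have "integrable M (\<lambda>w. (\<Sum>(a, t, C)\<in>P. ?J a t C w) + \<alpha>)"
      using int_sum by simp
    then show ?thesis
      by (rule Bochner_Integration.integrable_cong[THEN iffD1, rotated 2]) (auto simp flip: split)
  qed

  define q where "q a t C = sampling_prob w0 w1 a t * u C a t" for a t C
  have nonpos: "(\<Sum>t\<in>binary_matrices. \<Sum>C\<in>UNIV. q a t C * \<psi> a t C x) \<le> 0" for a x
  proof -
    have "(\<Sum>C\<in>UNIV. q a t C * \<psi> a t C x) =
        (\<Sum>C | C \<subseteq> sampled_nonedges a t \<and> card C = l' a t.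
          sampling_prob w0 w1 a t / real (card (sampled_nonedges a t) choose card C) *
          (FDP (test_nulls a t) (benjamini_hochberg \<alpha> (conformal_pvalue
            (g (observed_adjacency t a, x, train_sampling t C)) (card C) C) (test_pairs t)) - \<alpha>))" for t
      by (intro sum.mono_neutral_cong_right)
        (auto simp: q_def u_def \<psi>_def conformal_link_prediction_def train_scores_def)
    then show ?thesis
      using sum_FDP_sampling_le[OF w0 w1, of \<alpha> a "\<lambda>b s. g (b, x, s)" L] \<alpha> by (simp add: l'_def)
  qed

  have "(\<integral>w. (\<Sum>(a, t, C)\<in>P. ?J a t C w) \<partial>M) = (\<Sum>(a, t, C)\<in>P. (\<integral>w. ?J a t C w \<partial>M))"
    by (subst Bochner_Integration.integral_sum) (auto simp: P_def split_def intro: int_J)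
  also have "\<dots> = (\<Sum>(a, t, C)\<in>P. (\<integral>w. q a t C * \<psi> a t C (X w) * ?at a w \<partial>M))"
  proof (intro sum.cong refl)
    fix p assume "p \<in> P"
    then obtain a t C where p: "p = (a, t, C)" "a \<in> binary_matrices" "t \<in> binary_matrices"
      by (auto simp: P_def)
    show "(case p of (a, t, C) \<Rightarrow> (\<integral>w. ?J a t C w \<partial>M)) =
        (case p of (a, t, C) \<Rightarrow> (\<integral>w. q a t C * \<psi> a t C (X w) * ?at a w \<partial>M))"
      unfolding p(1) prod.case q_def
      by (rule integral_fixed_sampling[OF prob Astar_rv X_rv Om_rv Dcal_rv
            Om_law[OF p(3), unfolded G_AX_def] Dcal_law[unfolded G_Zstar_def]
            \<psi>_measurable[OF p(2,3)] \<psi>_bound])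
  qed
  also have "\<dots> = (\<integral>w. (\<Sum>(a, t, C)\<in>P. q a t C * \<psi> a t C (X w) * ?at a w) \<partial>M)"
    by (subst Bochner_Integration.integral_sum) (auto simp: P_def split_def intro: int_a)
  also have "\<dots> = (\<integral>w. (\<Sum>a\<in>binary_matrices. ?at a w *
      (\<Sum>t\<in>binary_matrices. \<Sum>C\<in>UNIV. q a t C * \<psi> a t C (X w))) \<partial>M)"
    by (simp add: P_def sum.cartesian_product[symmetric] sum_distrib_left mult.commute)
  also have "\<dots> \<le> 0"
  proof -
    have "(\<Sum>a\<in>binary_matrices. ?at a w *
      (\<Sum>t\<in>binary_matrices. \<Sum>C\<in>UNIV. q a t C * \<psi> a t C (X w))) \<le> 0" for w
      by (intro sum_nonpos mult_nonneg_nonpos nonpos) simp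
    then have "0 \<le> (\<integral>w. - (\<Sum>a\<in>binary_matrices. ?at a w *
      (\<Sum>t\<in>binary_matrices. \<Sum>C\<in>UNIV. q a t C * \<psi> a t C (X w))) \<partial>M)"
      by (intro integral_nonneg_AE AE_I2) simp
    then show ?thesis by simp
  qed
  finally have "(\<integral>w. ?FDP w - \<alpha> \<partial>M) \<le> 0"
    by (subst Bochner_Integration.integral_cong[OF refl split])
  then show ?thesis
    using int_FDP by (simp add: prob_space)
qed

end
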